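(* Let $H\in(0,1/2]$ and let $\mathbf{B}^H=\{\mathbf{B}^H_U;\,U\in\mathcal{A}\}$ be a set-indexed fractional Brownian motion of index $H$. Assume there exists a non-trivial group $G$ which operates on $\mathcal{A}$, whose operation can be extended so that for all $U,V\in\mathcal{A}$ and $g\in G$, $$g.(U\cup V)=g.U\cup g.V,\qquad g.(U\setminus V)=g.U\setminus g.V,$$ and that there exists a non-constant function $\mu:G\to(0,\infty)$ such that $m(g.U)=\mu(g)\,m(U)$ for all $U\in\mathcal{A}$, $g\in G$. Then $\mathbf{B}^H$ is self-similar of index $H$: for all $g\in G$, the processes $\{\mathbf{B}^H_{g.U};\,U\in\mathcal{A}\}$ and $\{\mu(g)^H\,\mathbf{B}^H_U;\,U\in\mathcal{A}\}$ have the same law.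
   Context: $\mathcal{T}$ is a locally compact complete separable metric space with a Borel measure $m$. $\overline{(\cdot)}$ and $(\cdot)^\circ$ denote closure and interior. For a class $\mathcal{D}$ of sets, $\mathcal{D}(u)$ is the class of finite unions of members of $\mathcal{D}$. $\mathcal{A}$ is an indexing collection, i.e. a nonempty class of compact connected subsets of $\mathcal{T}$ such that: (1) $\emptyset\in\mathcal{A}$; $A^\circ\ne A$ if $A\in\mathcal{A}$, $A\notin\{\emptyset,\mathcal{T}\}$; there is an increasing sequence $(B_n)$ in $\mathcal{A}(u)$ with $\mathcal{T}=\bigcup_n B_n^\circ$. (2) $\mathcal{A}$ is closed under arbitrary intersections, and if $A,B\in\mathcal{A}$ are nonempty then $A\cap B\neq\emptyset$; if $(A_i)$ is an increasing sequence in $\mathcal{A}$ and there is $n$ with $A_i\subseteq B_n$ for all $i$, then $\overline{\bigcup_iA_i}\in\mathcal{A}$. (3) $\sigma(\mathcal{A})$ is the Borel $\sigma$-algebra of $\mathcal{T}$. (4) There are an increasing sequence of finite subclasses $\mathcal{A}_n\subseteq\mathcal{A}$ closed under intersections with $\emptyset,B_n\in\mathcal{A}_n(u)$, and functions $g_n:\mathcal{A}\to\mathcal{A}_n(u)\cup\{\mathcal{T}\}$ such that: (a) $g_n$ preserves arbitrary intersections and finite unions (i.e. $g_n(\bigcap_{A\in\mathcal{A}'}A)=\bigcap_{A\in\mathcal{A}'}g_n(A)$ for $\mathcal{A}'\subseteq\mathcal{A}$, and $\bigcup_{i=1}^kA_i=\bigcup_{j=1}^lA'_j$ implies $\bigcup_{i=1}^kg_n(A_i)=\bigcup_{j=1}^lg_n(A'_j)$);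 (b) $A\subseteq(g_n(A))^\circ$ for $A\in\mathcal{A}$; (c) $g_n(A)\subseteq g_k(A)$ if $n\ge k$; (d) $A=\bigcap_ng_n(A)$; (e) for $A,A'\in\mathcal{A}$, $g_n(A)\cap A'\in\mathcal{A}$, and if $A'\in\mathcal{A}_n$ then $g_n(A)\cap A'\in\mathcal{A}_n$; (f) $g_n(\emptyset)=\emptyset$. (5) Every countable intersection of sets in $\mathcal{A}(u)$ is the closure of a countable union of sets in $\mathcal{A}$. It is understood that $m(U)<\infty$ for $U\in\mathcal{A}$. A set-indexed fractional Brownian motion (sifBm) of index $H\in(0,1/2]$ is a mean-zero Gaussian process $\{\mathbf{B}^H_U;\,U\in\mathcal{A}\}$ with $E[\mathbf{B}^H_U\mathbf{B}^H_V]=\frac12\left[m(U)^{2H}+m(V)^{2H}-m(U\bigtriangleup V)^{2H}\right]$ for $U,V\in\mathcal{A}$, where $\bigtriangleup$ is symmetric difference. "Operates on $\mathcal{A}$" means $G$ acts on the set $\mathcal{A}$ (so $g.U\in\mathcal{A}$ for $U\in\mathcal{A}$); the extension of the action is to the sets obtained from $\mathcal{A}$ by finite unions and differences. Equality in law of processes means equality of finite-dimensional distributions. *)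

theory Defs
  imports "HOL-Probability.Probability" "HOL-Algebra.Group_Action"
begin

text \<open>The space \<open>\<T>\<close> is the whole type. Unions are over nonempty finite families, so that
  \<open>{} \<in> finite_unions D\<close> iff \<open>{} \<in> D\<close>.\<close>

definition finite_unions :: "'a set set \<Rightarrow> 'a set set" where
  "finite_unions D = {\<Union>F | F. finite F \<and> F \<noteq> {} \<and> F \<subseteq> D}"

text \<open>Intersections are over nonempty families: the empty intersection would be \<open>\<T>\<close>, which
  need not be compact.\<close>

locale indexing_data =
  fixes \<A> :: "'a::polish_space set set"
    and B :: "nat \<Rightarrow> 'a set"
    and An :: "nat \<Rightarrow> 'a set set"
    and g :: "nat \<Rightarrow> 'a set \<Rightarrow> 'a set"
  assumes nonempty: "\<A> \<noteq> {}"
    and compact: "\<And>A. A \<in> \<A> \<Longrightarrow> compact A"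
    and connected: "\<And>A. A \<in> \<A> \<Longrightarrow> connected A"
    and empty_mem: "{} \<in> \<A>"
    and interior_neq: "\<And>A. A \<in> \<A> \<Longrightarrow> A \<notin> {{}, UNIV} \<Longrightarrow> interior A \<noteq> A"
    and B_mem: "\<And>n. B n \<in> finite_unions \<A>"
    and B_incseq: "incseq B"
    and B_exhausts: "(\<Union>n. interior (B n)) = UNIV"
    and Inter_mem: "\<And>\<D>. \<D> \<subseteq> \<A> \<Longrightarrow> \<D> \<noteq> {} \<Longrightarrow> \<Inter>\<D> \<in> \<A>"
    and Int_nonempty: "\<And>A A'. A \<in> \<A> \<Longrightarrow> A' \<in> \<A> \<Longrightarrow> A \<noteq> {} \<Longrightarrow> A' \<noteq> {} \<Longrightarrow> A \<inter> A' \<noteq> {}"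
    and closure_UN_mem:
      "\<And>C n. range C \<subseteq> \<A> \<Longrightarrow> incseq C \<Longrightarrow> (\<And>i. C i \<subseteq> B n) \<Longrightarrow> closure (\<Union>i::nat. C i) \<in> \<A>"
    and sigma_borel: "sigma_sets UNIV \<A> = sets borel"
    and An_incseq: "incseq An"
    and An_finite: "\<And>n. finite (An n)"
    and An_subset: "\<And>n. An n \<subseteq> \<A>"
    and An_Inter: "\<And>n \<D>. \<D> \<subseteq> An n \<Longrightarrow> \<D> \<noteq> {} \<Longrightarrow> \<Inter>\<D> \<in> An n"
    and An_empty: "\<And>n. {} \<in> finite_unions (An n)"
    and An_B: "\<And>n. B n \<in> finite_unions (An n)"
    and g_mem: "\<And>n A. A \<in> \<A> \<Longrightarrow> g n A \<in> finite_unions (An n) \<union> {UNIV}"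
    and g_Inter: "\<And>n \<D>. \<D> \<subseteq> \<A> \<Longrightarrow> \<D> \<noteq> {} \<Longrightarrow> g n (\<Inter>\<D>) = (\<Inter>A\<in>\<D>. g n A)"
    and g_Union: "\<And>n \<D> \<D>'. finite \<D> \<Longrightarrow> \<D> \<noteq> {} \<Longrightarrow> \<D> \<subseteq> \<A> \<Longrightarrow> finite \<D>' \<Longrightarrow> \<D>' \<noteq> {} \<Longrightarrow> \<D>' \<subseteq> \<A> \<Longrightarrow>
        \<Union>\<D> = \<Union>\<D>' \<Longrightarrow> (\<Union>A\<in>\<D>. g n A) = (\<Union>A\<in>\<D>'. g n A)"
    and g_interior: "\<And>n A. A \<in> \<A> \<Longrightarrow> A \<subseteq> interior (g n A)"
    and g_antimono: "\<And>n k A. A \<in> \<A> \<Longrightarrow> k \<le> n \<Longrightarrow> g n A \<subseteq> g k A"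
    and g_limit: "\<And>A. A \<in> \<A> \<Longrightarrow> A = (\<Inter>n. g n A)"
    and g_Int_mem: "\<And>n A A'. A \<in> \<A> \<Longrightarrow> A' \<in> \<A> \<Longrightarrow> g n A \<inter> A' \<in> \<A>"
    and g_Int_mem_An: "\<And>n A A'. A \<in> \<A> \<Longrightarrow> A' \<in> An n \<Longrightarrow> g n A \<inter> A' \<in> An n"
    and g_empty: "\<And>n. g n {} = {}"
    and Inter_closure_Union:
      "\<And>\<C>. countable \<C> \<Longrightarrow> \<C> \<noteq> {} \<Longrightarrow> \<C> \<subseteq> finite_unions \<A> \<Longrightarrow>
        \<exists>\<D>. countable \<D> \<and> \<D> \<subseteq> \<A> \<and> \<Inter>\<C> = closure (\<Union>\<D>)"

definition indexing_collection :: "'a::polish_space set set \<Rightarrow> bool" where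
  "indexing_collection \<A> \<longleftrightarrow> (\<exists>B An g. indexing_data \<A> B An g)"

text \<open>Degenerate (constant) variables count as Gaussian: the sifBm vanishes on null sets.\<close>

definition gaussian_variable :: "'w measure \<Rightarrow> ('w \<Rightarrow> real) \<Rightarrow> bool" where
  "gaussian_variable M X \<longleftrightarrow> X \<in> borel_measurable M \<and>
     ((\<exists>c. distr M borel X = return borel c) \<or>
      (\<exists>c \<sigma>. \<sigma> > 0 \<and> distributed M lborel X (normal_density c \<sigma>)))"

definition gaussian_process :: "'w measure \<Rightarrow> 'i set \<Rightarrow> ('i \<Rightarrow> 'w \<Rightarrow> real) \<Rightarrow> bool" where
  "gaussian_process M I X \<longleftrightarrow> prob_space M \<and>
     (\<forall>F c. finite F \<longrightarrow> F \<subseteq> I \<longrightarrow> gaussian_variable M (\<lambda>\<omega>. \<Sum>i\<in>F. c i * X i \<omega>))"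

definition sifBm ::
  "'w measure \<Rightarrow> 'a measure \<Rightarrow> 'a set set \<Rightarrow> real \<Rightarrow> ('a set \<Rightarrow> 'w \<Rightarrow> real) \<Rightarrow> bool" where
  "sifBm M m \<A> H X \<longleftrightarrow> 0 < H \<and> H \<le> 1 / 2 \<and> gaussian_process M \<A> X \<and>
     (\<forall>U\<in>\<A>. (\<integral>\<omega>. X U \<omega> \<partial>M) = 0) \<and>
     (\<forall>U\<in>\<A>. \<forall>V\<in>\<A>. (\<integral>\<omega>. X U \<omega> * X V \<omega> \<partial>M) =
        1 / 2 * (measure m U powr (2 * H) + measure m V powr (2 * H)
                 - measure m (sym_diff U V) powr (2 * H)))"

definition same_law ::
  "'w measure \<Rightarrow> 'v measure \<Rightarrow> 'i set \<Rightarrow> ('i \<Rightarrow> 'w \<Rightarrow> real) \<Rightarrow> ('i \<Rightarrow> 'v \<Rightarrow> real) \<Rightarrow> bool" where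
  "same_law M N I X Y \<longleftrightarrow> (\<forall>F. finite F \<longrightarrow> F \<subseteq> I \<longrightarrow>
     distr M (\<Pi>\<^sub>M i\<in>F. borel) (\<lambda>\<omega>. \<lambda>i\<in>F. X i \<omega>) =
     distr N (\<Pi>\<^sub>M i\<in>F. borel) (\<lambda>\<omega>. \<lambda>i\<in>F. Y i \<omega>))"

inductive_set union_diff_closure :: "'a set set \<Rightarrow> 'a set set" for \<A> where
  base: "U \<in> \<A> \<Longrightarrow> U \<in> union_diff_closure \<A>"
| union: "U \<in> union_diff_closure \<A> \<Longrightarrow> V \<in> union_diff_closure \<A> \<Longrightarrow> U \<union> V \<in> union_diff_closure \<A>"
| diff: "U \<in> union_diff_closure \<A> \<Longrightarrow> V \<in> union_diff_closure \<A> \<Longrightarrow> U - V \<in> union_diff_closure \<A>"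

text \<open>The compatibility with unions and differences is required for members of \<open>\<A>\<close> only; the
  extension is what gives \<open>\<psi> x (U \<union> V)\<close> and \<open>\<psi> x (U - V)\<close> a meaning.\<close>

definition extends_to_unions_diffs ::
  "('g, 'x) monoid_scheme \<Rightarrow> 'a set set \<Rightarrow> ('g \<Rightarrow> 'a set \<Rightarrow> 'a set) \<Rightarrow> bool" where
  "extends_to_unions_diffs G \<A> \<phi> \<longleftrightarrow>
     (\<exists>\<psi>. group_action G (union_diff_closure \<A>) \<psi> \<and>
        (\<forall>x\<in>carrier G. \<forall>U\<in>\<A>. \<psi> x U = \<phi> x U) \<and>
        (\<forall>x\<in>carrier G. \<forall>U\<in>\<A>. \<forall>V\<in>\<A>.
            \<psi> x (U \<union> V) = \<psi> x U \<union> \<psi> x V \<and> \<psi> x (U - V) = \<psi> x U - \<psi> x V))"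

end

theory Submission
  imports Defs
begin

text \<open>A centered Gaussian process is determined in law by its covariance, so it suffices to compare
covariances. The covariance of a set-indexed fractional Brownian motion depends only on the numbers
\<open>m(U)\<close>, \<open>m(V)\<close> and \<open>m(U \<Delta> V)\<close>. If the action of \<open>x\<close> multiplies all three by
\<open>\<mu> x\<close>, then it multiplies the covariance by \<open>\<mu> x powr (2 * H)\<close>, which is also the effect of
multiplying the process by \<open>\<mu> x powr H\<close>.

That \<open>m(U \<Delta> V)\<close> is scaled is not immediate, because the scaling hypothesis concerns members
of \<open>\<A>\<close> only and symmetric differences need not be among them. But \<open>\<A>\<close> is closed under
intersections, and \<open>m(U \<Delta> V) = m(U) + m(V) - 2 m(U \<inter> V)\<close>; so it is enough that the
action commutes with intersections of members of \<open>\<A>\<close>. This follows from compatibility with unions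
and differences (\<open>extended_action_Int\<close>, used in \<open>measure_sym_diff_scales\<close>).

That the covariance determines the law (\<open>gaussian_process_same_lawI\<close>) is reduced to one dimension.
Every linear combination of the coordinates is a centered Gaussian variable, and such a variable is
determined in law by its second moment (\<open>centered_gaussian_variable\<close>). The laws of all linear
combinations determine the joint law by the Cramer-Wold theorem (\<open>cramer_wold\<close>), which is proved
from the one-dimensional uniqueness theorem for characteristic functions by treating
the coordinates one after another.\<close>

section \<open>The Cramer-Wold theorem\<close>

text \<open>A real form of the characteristic function: cosines with arbitrary phase carry the same
information as complex exponentials, and they allow weights to stay real.\<close>

lemma (in real_distribution) char_eq_cos:
  "char M t = Complex (\<integral>x. cos (t * x) \<partial>M) (\<integral>x. cos (t * x - pi / 2) \<partial>M)"
proof -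
  have i: "integrable M (\<lambda>x. iexp (t * x))"
    by (intro integrable_const_bound[of _ 1]) auto
  have "Re (char M t) = (\<integral>x. cos (t * x) \<partial>M)"
    unfolding char_def using integral_Re[OF i, symmetric] by (simp add: Re_exp)
  moreover have "Im (char M t) = (\<integral>x. sin (t * x) \<partial>M)"
    unfolding char_def using integral_Im[OF i, symmetric] by (simp add: Im_exp)
  ultimately show ?thesis
    by (simp add: complex_eq_iff cos_diff)
qed

text \<open>Normalising the weights to probability densities reduces the claim to the uniqueness theorem for
characteristic functions. Only weights of total mass zero need a separate, trivial argument.\<close>

lemma weighted_law_eqI:
  fixes X :: "'a \<Rightarrow> real" and Y :: "'b \<Rightarrow> real" and u :: "'a \<Rightarrow> real" and v :: "'b \<Rightarrow> real"
  assumes [measurable]: "X \<in> borel_measurable M" "Y \<in> borel_measurable N" "A \<in> sets borel"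
    and u: "integrable M u" "\<And>\<omega>. 0 \<le> u \<omega>"
    and v: "integrable N v" "\<And>\<omega>. 0 \<le> v \<omega>"
    and eq: "\<And>t \<theta>. (\<integral>\<omega>. u \<omega> * cos (t * X \<omega> + \<theta>) \<partial>M) = (\<integral>\<omega>. v \<omega> * cos (t * Y \<omega> + \<theta>) \<partial>N)"
  shows "(\<integral>\<omega>. u \<omega> * indicator A (X \<omega>) \<partial>M) = (\<integral>\<omega>. v \<omega> * indicator A (Y \<omega>) \<partial>N)"
proof -
  have [measurable]: "u \<in> borel_measurable M" "v \<in> borel_measurable N"
    using u(1) v(1) by auto
  define c where "c = (\<integral>\<omega>. u \<omega> \<partial>M)"
  have c: "c = (\<integral>\<omega>. v \<omega> \<partial>N)"
    using eq[of 0 0] by (simp add: c_def)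
  have "c \<ge> 0" unfolding c_def using u(2) by simp
  show ?thesis
  proof (cases "c = 0")
    case True
    then have "AE \<omega> in M. u \<omega> = 0" "AE \<omega> in N. v \<omega> = 0"
      using c c_def u v integral_nonneg_eq_0_iff_AE[of M u] integral_nonneg_eq_0_iff_AE[of N v]
      by auto
    then have "(\<integral>\<omega>. u \<omega> * indicator A (X \<omega>) \<partial>M) = 0"
      and "(\<integral>\<omega>. v \<omega> * indicator A (Y \<omega>) \<partial>N) = 0"
      by (auto intro!: integral_eq_zero_AE elim!: eventually_mono)
    then show ?thesis by simp
  next
    case False
    with \<open>c \<ge> 0\<close> have "c > 0" by simp
    define P where "P = distr (density M (\<lambda>\<omega>. u \<omega> / c)) borel X"
    define Q where "Q = distr (density N (\<lambda>\<omega>. v \<omega> / c)) borel Y"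
    have "prob_space (density M (\<lambda>\<omega>. u \<omega> / c))"
      using u \<open>c > 0\<close>
      by (intro prob_spaceI) (simp add: emeasure_density nn_integral_eq_integral c_def)
    then have "real_distribution P"
      unfolding P_def by (intro prob_space.real_distribution_distr) auto
    then interpret P: real_distribution P .
    have "prob_space (density N (\<lambda>\<omega>. v \<omega> / c))"
      using v \<open>c > 0\<close>
      by (intro prob_spaceI) (simp add: emeasure_density nn_integral_eq_integral c)
    then have "real_distribution Q"
      unfolding Q_def by (intro prob_space.real_distribution_distr) auto
    then interpret Q: real_distribution Q .
    have P_int: "(\<integral>x. f x \<partial>P) = (\<integral>\<omega>. u \<omega> * f (X \<omega>) \<partial>M) / c"
      if [measurable]: "f \<in> borel_measurable borel" for f :: "real \<Rightarrow> real"
      unfolding P_def using u(2) \<open>c > 0\<close>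
      by (simp add: integral_distr integral_density)
    have Q_int: "(\<integral>x. f x \<partial>Q) = (\<integral>\<omega>. v \<omega> * f (Y \<omega>) \<partial>N) / c"
      if [measurable]: "f \<in> borel_measurable borel" for f :: "real \<Rightarrow> real"
      unfolding Q_def using v(2) \<open>c > 0\<close>
      by (simp add: integral_distr integral_density)
    have "char P = char Q"
    proof
      fix t
      show "char P t = char Q t"
        unfolding P.char_eq_cos Q.char_eq_cos
        using eq[of t 0] eq[of t "- (pi / 2)"] by (simp add: P_int Q_int)
    qed
    then have "P = Q"
      by (rule Levy_uniqueness[OF \<open>real_distribution P\<close> \<open>real_distribution Q\<close>])
    then show ?thesis
      using P_int[of "indicator A"] Q_int[of "indicator A"] \<open>c > 0\<close> by simp
  qed
qed

text \<open>In the proof of the Cramer-Wold theorem the weights are products of indicators and cosines, hence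
bounded but not nonnegative.\<close>

lemma signed_weighted_law_eqI:
  fixes X :: "'a \<Rightarrow> real" and Y :: "'b \<Rightarrow> real" and u :: "'a \<Rightarrow> real" and v :: "'b \<Rightarrow> real"
  assumes "prob_space M" "prob_space N"
    and [measurable]: "X \<in> borel_measurable M" "Y \<in> borel_measurable N" "A \<in> sets borel"
    and law: "distr M borel X = distr N borel Y"
    and [measurable]: "u \<in> borel_measurable M" "v \<in> borel_measurable N"
    and u: "\<And>\<omega>. \<bar>u \<omega>\<bar> \<le> 1" and v: "\<And>\<omega>. \<bar>v \<omega>\<bar> \<le> 1"
    and eq: "\<And>t \<theta>. (\<integral>\<omega>. u \<omega> * cos (t * X \<omega> + \<theta>) \<partial>M) = (\<integral>\<omega>. v \<omega> * cos (t * Y \<omega> + \<theta>) \<partial>N)"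
  shows "(\<integral>\<omega>. u \<omega> * indicator A (X \<omega>) \<partial>M) = (\<integral>\<omega>. v \<omega> * indicator A (Y \<omega>) \<partial>N)"
proof -
  interpret M: prob_space M by fact
  interpret N: prob_space N by fact
  have iu: "integrable M u" and iv: "integrable N v"
    using u v by (auto intro!: M.integrable_const_bound[of _ 1] N.integrable_const_bound[of _ 1])
  have plain: "(\<integral>\<omega>. f (X \<omega>) \<partial>M) = (\<integral>\<omega>. f (Y \<omega>) \<partial>N)"
    if [measurable]: "f \<in> borel_measurable borel" for f :: "real \<Rightarrow> real"
    using arg_cong[OF law, of "\<lambda>P. integral\<^sup>L P f"] by (simp add: integral_distr)
  have shiftM: "(\<integral>\<omega>. (u \<omega> + 1) * f (X \<omega>) \<partial>M) = (\<integral>\<omega>. u \<omega> * f (X \<omega>) \<partial>M) + (\<integral>\<omega>. f (X \<omega>) \<partial>M)"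
    if [measurable]: "f \<in> borel_measurable borel" and f: "\<And>x. \<bar>f x\<bar> \<le> 1" for f :: "real \<Rightarrow> real"
  proof -
    have "integrable M (\<lambda>\<omega>. f (X \<omega>))" "integrable M (\<lambda>\<omega>. u \<omega> * f (X \<omega>))"
      using f u by (auto intro!: M.integrable_const_bound[of _ 1] AE_I2 mult_le_one simp: abs_mult)
    then show ?thesis by (simp add: distrib_right)
  qed
  have shiftN: "(\<integral>\<omega>. (v \<omega> + 1) * f (Y \<omega>) \<partial>N) = (\<integral>\<omega>. v \<omega> * f (Y \<omega>) \<partial>N) + (\<integral>\<omega>. f (Y \<omega>) \<partial>N)"
    if [measurable]: "f \<in> borel_measurable borel" and f: "\<And>x. \<bar>f x\<bar> \<le> 1" for f :: "real \<Rightarrow> real"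
  proof -
    have "integrable N (\<lambda>\<omega>. f (Y \<omega>))" "integrable N (\<lambda>\<omega>. v \<omega> * f (Y \<omega>))"
      using f v by (auto intro!: N.integrable_const_bound[of _ 1] AE_I2 mult_le_one simp: abs_mult)
    then show ?thesis by (simp add: distrib_right)
  qed
  \<comment> \<open>u + 1 and v + 1 are nonnegative, and the summand 1 contributes equally on both sides
    because X and Y have the same law.\<close>
  have "(\<integral>\<omega>. (u \<omega> + 1) * indicator A (X \<omega>) \<partial>M) = (\<integral>\<omega>. (v \<omega> + 1) * indicator A (Y \<omega>) \<partial>N)"
  proof (rule weighted_law_eqI)
    show "0 \<le> u \<omega> + 1" for \<omega> using u[of \<omega>] by linarith
    show "0 \<le> v \<omega> + 1" for \<omega> using v[of \<omega>] by linarith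
    show "(\<integral>\<omega>. (u \<omega> + 1) * cos (t * X \<omega> + \<theta>) \<partial>M) = (\<integral>\<omega>. (v \<omega> + 1) * cos (t * Y \<omega> + \<theta>) \<partial>N)" for t \<theta>
      using shiftM[of "\<lambda>x. cos (t * x + \<theta>)"] shiftN[of "\<lambda>x. cos (t * x + \<theta>)"]
        plain[of "\<lambda>x. cos (t * x + \<theta>)"] eq[of t \<theta>] by simp
  qed (use iu iv in auto)
  then show ?thesis
    using shiftM[of "indicator A"] shiftN[of "indicator A"] plain[of "indicator A"]
    by (simp add: indicator_def)
qed

text \<open>The joint law is determined by the probabilities of boxes, that is by expectations of products
of indicators of the coordinates, whereas the hypothesis gives the expectations of cosines of linear
combinations. Induction over the coordinates leads from one to the other: all other factors are
collected in a bounded weight, and the preceding lemma replaces the dependence on one coordinate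
through a cosine of arbitrary frequency by the indicator of an arbitrary Borel set.\<close>

lemma cramer_wold:
  fixes X :: "'i \<Rightarrow> 'a \<Rightarrow> real" and Y :: "'i \<Rightarrow> 'b \<Rightarrow> real"
  assumes "prob_space M" "prob_space N" and fin: "finite F"
    and X: "\<And>i. i \<in> F \<Longrightarrow> X i \<in> borel_measurable M"
    and Y: "\<And>i. i \<in> F \<Longrightarrow> Y i \<in> borel_measurable N"
    and law: "\<And>c. distr M borel (\<lambda>\<omega>. \<Sum>i\<in>F. c i * X i \<omega>) = distr N borel (\<lambda>\<omega>. \<Sum>i\<in>F. c i * Y i \<omega>)"
  shows "distr M (\<Pi>\<^sub>M i\<in>F. borel) (\<lambda>\<omega>. \<lambda>i\<in>F. X i \<omega>) = distr N (\<Pi>\<^sub>M i\<in>F. borel) (\<lambda>\<omega>. \<lambda>i\<in>F. Y i \<omega>)"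
proof -
  interpret M: prob_space M by fact
  interpret N: prob_space N by fact
  note X[measurable] Y[measurable]
  \<comment> \<open>Interpolates between the law of linear combinations (S empty) and the joint law (S = F), by
    turning one frequency at a time into an indicator. The free phase keeps the family closed under
    multiplication by a further cosine.\<close>
  have mixed: "(\<integral>\<omega>. (\<Prod>i\<in>S. indicator (A i) (X i \<omega>)) * cos ((\<Sum>i\<in>F - S. t i * X i \<omega>) + \<theta>) \<partial>M) =
      (\<integral>\<omega>. (\<Prod>i\<in>S. indicator (A i) (Y i \<omega>)) * cos ((\<Sum>i\<in>F - S. t i * Y i \<omega>) + \<theta>) \<partial>N)"
    if "S \<subseteq> F" "\<And>i. i \<in> S \<Longrightarrow> A i \<in> sets borel" for S A t \<theta>
    using finite_subset[OF that(1) fin] that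
  proof (induction S arbitrary: t \<theta> rule: finite_induct)
    case empty
    have "(\<integral>\<omega>. cos ((\<Sum>i\<in>F. t i * X i \<omega>) + \<theta>) \<partial>M) = (\<integral>x. cos (x + \<theta>) \<partial>distr M borel (\<lambda>\<omega>. \<Sum>i\<in>F. t i * X i \<omega>))"
      by (subst integral_distr) auto
    also have "\<dots> = (\<integral>\<omega>. cos ((\<Sum>i\<in>F. t i * Y i \<omega>) + \<theta>) \<partial>N)"
      unfolding law by (subst integral_distr) auto
    finally show ?case by simp
  next
    case (insert k S)
    then have k: "k \<in> F" "k \<in> F - S" and [measurable]: "\<And>i. i \<in> S \<Longrightarrow> i \<in> F" by auto
    have [measurable]: "A k \<in> sets borel" "\<And>i. i \<in> S \<Longrightarrow> A i \<in> sets borel" 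
      using insert.prems by auto
    have [measurable]: "X k \<in> borel_measurable M" "Y k \<in> borel_measurable N"
      using k X Y by auto
    have "finite (F - S)" using fin by simp
    define cX where "cX t \<theta> \<omega> = cos ((\<Sum>i\<in>F - insert k S. t i * X i \<omega>) + \<theta>)" for t \<theta> \<omega>
    define cY where "cY t \<theta> \<omega> = cos ((\<Sum>i\<in>F - insert k S. t i * Y i \<omega>) + \<theta>)" for t \<theta> \<omega>
    define pX where "pX \<omega> = (\<Prod>i\<in>S. indicator (A i) (X i \<omega>) :: real)" for \<omega>
    define pY where "pY \<omega> = (\<Prod>i\<in>S. indicator (A i) (Y i \<omega>) :: real)" for \<omega>
    have [measurable]: "cX t \<theta> \<in> borel_measurable M" "cY t \<theta> \<in> borel_measurable N" for t \<theta>
      unfolding cX_def cY_def by measurable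
    have [measurable]: "pX \<in> borel_measurable M" "pY \<in> borel_measurable N"
      unfolding pX_def pY_def by measurable
    have p01: "\<bar>pX \<omega>\<bar> \<le> 1" "\<bar>pY \<omega>'\<bar> \<le> 1" for \<omega> \<omega>'
      unfolding pX_def pY_def abs_prod by (auto intro!: prod_le_1)
    have c01: "\<bar>cX t \<theta> \<omega>\<bar> \<le> 1" "\<bar>cY t \<theta> \<omega>'\<bar> \<le> 1" for t \<theta> \<omega> \<omega>'
      unfolding cX_def cY_def by auto
    have sumX: "cos ((\<Sum>i\<in>F - S. (t(k := s)) i * X i \<omega>) + \<theta>) =
        cos ((\<Sum>i\<in>F - insert k S. t i * X i \<omega>) + s * X k \<omega> + \<theta>)" for t s \<theta> \<omega>
    proof -
      have "(\<Sum>i\<in>F - S. (t(k := s)) i * X i \<omega>) = s * X k \<omega> + (\<Sum>i\<in>F - S - {k}. (t(k := s)) i * X i \<omega>)"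
        using k \<open>finite (F - S)\<close> by (subst sum.remove[of _ k]) auto
      also have "F - S - {k} = F - insert k S" by blast
      also have "(\<Sum>i\<in>F - insert k S. (t(k := s)) i * X i \<omega>) = (\<Sum>i\<in>F - insert k S. t i * X i \<omega>)"
        by (intro sum.cong) auto
      finally show ?thesis by (simp add: add_ac)
    qed
    have sumY: "cos ((\<Sum>i\<in>F - S. (t(k := s)) i * Y i \<omega>) + \<theta>) =
        cos ((\<Sum>i\<in>F - insert k S. t i * Y i \<omega>) + s * Y k \<omega> + \<theta>)" for t s \<theta> \<omega>
    proof -
      have "(\<Sum>i\<in>F - S. (t(k := s)) i * Y i \<omega>) = s * Y k \<omega> + (\<Sum>i\<in>F - S - {k}. (t(k := s)) i * Y i \<omega>)"
        using k \<open>finite (F - S)\<close> by (subst sum.remove[of _ k]) auto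
      also have "F - S - {k} = F - insert k S" by blast
      also have "(\<Sum>i\<in>F - insert k S. (t(k := s)) i * Y i \<omega>) = (\<Sum>i\<in>F - insert k S. t i * Y i \<omega>)"
        by (intro sum.cong) auto
      finally show ?thesis by (simp add: add_ac)
    qed
    have IH: "(\<integral>\<omega>. pX \<omega> * cos ((\<Sum>i\<in>F - insert k S. t i * X i \<omega>) + s * X k \<omega> + \<theta>) \<partial>M) =
        (\<integral>\<omega>. pY \<omega> * cos ((\<Sum>i\<in>F - insert k S. t i * Y i \<omega>) + s * Y k \<omega> + \<theta>) \<partial>N)" for t s \<theta>
      using insert.IH[of "t(k := s)" \<theta>] insert.prems unfolding sumX sumY pX_def pY_def by auto
    have "(\<integral>\<omega>. (pX \<omega> * cX t \<theta> \<omega>) * indicator (A k) (X k \<omega>) \<partial>M) =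
        (\<integral>\<omega>. (pY \<omega> * cY t \<theta> \<omega>) * indicator (A k) (Y k \<omega>) \<partial>N)"
    proof (rule signed_weighted_law_eqI[OF assms(1,2)])
      have "(\<Sum>i\<in>F. (if i = k then 1 else 0) * Z i) = Z k" for Z :: "'i \<Rightarrow> real"
        using k fin by (subst sum.remove[of _ k]) auto
      then show "distr M borel (X k) = distr N borel (Y k)"
        using law[of "\<lambda>i. if i = k then 1 else 0"] by simp
      show "\<bar>pX \<omega> * cX t \<theta> \<omega>\<bar> \<le> 1" for \<omega> using p01 c01 by (auto simp: abs_mult intro!: mult_le_one)
      show "\<bar>pY \<omega> * cY t \<theta> \<omega>\<bar> \<le> 1" for \<omega> using p01 c01 by (auto simp: abs_mult intro!: mult_le_one)
      fix s \<theta>'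
      define qX where "qX s' \<theta>'' \<omega> = pX \<omega> * cos ((\<Sum>i\<in>F - insert k S. t i * X i \<omega>) + s' * X k \<omega> + \<theta>'')" for s' \<theta>'' \<omega>
      define qY where "qY s' \<theta>'' \<omega> = pY \<omega> * cos ((\<Sum>i\<in>F - insert k S. t i * Y i \<omega>) + s' * Y k \<omega> + \<theta>'')" for s' \<theta>'' \<omega>
      have q: "(\<integral>\<omega>. qX s' \<theta>'' \<omega> \<partial>M) = (\<integral>\<omega>. qY s' \<theta>'' \<omega> \<partial>N)" for s' \<theta>''
        unfolding qX_def qY_def by (rule IH)
      have qi: "integrable M (qX s' \<theta>'')" "integrable N (qY s' \<theta>'')" for s' \<theta>''
        unfolding qX_def qY_def using p01
        by (auto simp: abs_mult intro!: M.integrable_const_bound[of _ 1] N.integrable_const_bound[of _ 1] AE_I2 mult_le_one)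
      \<comment> \<open>The product formula for cosines leads back to the induction hypothesis, with frequencies
        -s and s at k.\<close>
      have prodX: "pX \<omega> * cX t \<theta> \<omega> * cos (s * X k \<omega> + \<theta>') = (qX (- s) (\<theta> - \<theta>') \<omega> + qX s (\<theta> + \<theta>') \<omega>) / 2" for \<omega>
        unfolding qX_def cX_def mult.assoc cos_times_cos by (simp add: algebra_simps)
      have prodY: "pY \<omega> * cY t \<theta> \<omega> * cos (s * Y k \<omega> + \<theta>') = (qY (- s) (\<theta> - \<theta>') \<omega> + qY s (\<theta> + \<theta>') \<omega>) / 2" for \<omega>
        unfolding qY_def cY_def mult.assoc cos_times_cos by (simp add: algebra_simps)
      show "(\<integral>\<omega>. pX \<omega> * cX t \<theta> \<omega> * cos (s * X k \<omega> + \<theta>') \<partial>M) =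
          (\<integral>\<omega>. pY \<omega> * cY t \<theta> \<omega> * cos (s * Y k \<omega> + \<theta>') \<partial>N)"
        unfolding prodX prodY by (simp add: q qi)
    qed auto
    then show ?case
      using insert.hyps by (simp add: cX_def cY_def pX_def pY_def mult_ac)
  qed
  have box: "measure M {\<omega> \<in> space M. \<forall>i\<in>F. X i \<omega> \<in> A i} = measure N {\<omega> \<in> space N. \<forall>i\<in>F. Y i \<omega> \<in> A i}"
    if A: "\<And>i. i \<in> F \<Longrightarrow> A i \<in> sets borel" for A
  proof -
    have ind: "(\<Prod>i\<in>F. indicator (A i) (Z i)) = (if \<forall>i\<in>F. Z i \<in> A i then 1 else 0 :: real)" for Z :: "'i \<Rightarrow> real"
      using fin by (auto simp: indicator_def)
    have "measure M {\<omega> \<in> space M. \<forall>i\<in>F. X i \<omega> \<in> A i} = (\<integral>\<omega>. indicator {\<omega> \<in> space M. \<forall>i\<in>F. X i \<omega> \<in> A i} \<omega> \<partial>M)"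
      by (subst Bochner_Integration.integral_indicator) (auto intro!: arg_cong[of _ _ "measure M"])
    also have "\<dots> = (\<integral>\<omega>. (\<Prod>i\<in>F. indicator (A i) (X i \<omega>)) \<partial>M)"
      by (intro Bochner_Integration.integral_cong refl, unfold ind) (auto simp: indicator_def)
    also have "\<dots> = (\<integral>\<omega>. (\<Prod>i\<in>F. indicator (A i) (Y i \<omega>)) \<partial>N)"
      using mixed[of F A "\<lambda>_. 0" 0] A by simp
    also have "\<dots> = (\<integral>\<omega>. indicator {\<omega> \<in> space N. \<forall>i\<in>F. Y i \<omega> \<in> A i} \<omega> \<partial>N)"
      by (intro Bochner_Integration.integral_cong refl, unfold ind) (auto simp: indicator_def)
    also have "\<dots> = measure N {\<omega> \<in> space N. \<forall>i\<in>F. Y i \<omega> \<in> A i}"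
      by (subst Bochner_Integration.integral_indicator) (auto intro!: arg_cong[of _ _ "measure N"])
    finally show ?thesis .
  qed
  have mX: "(\<lambda>\<omega>. \<lambda>i\<in>F. X i \<omega>) \<in> measurable M (\<Pi>\<^sub>M i\<in>F. borel)"
    and mY: "(\<lambda>\<omega>. \<lambda>i\<in>F. Y i \<omega>) \<in> measurable N (\<Pi>\<^sub>M i\<in>F. borel)"
    by (auto intro!: measurable_restrict)
  show ?thesis
  proof (rule measure_eqI_PiM_finite[where I = F and M = "\<lambda>_. borel" and A = "\<lambda>_. \<Pi>\<^sub>E i\<in>F. UNIV"])
    fix A :: "'i \<Rightarrow> real set" assume A: "\<And>i. i \<in> F \<Longrightarrow> A i \<in> sets borel"
    then have PA: "Pi\<^sub>E F A \<in> sets (\<Pi>\<^sub>M i\<in>F. borel)"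
      using fin by (intro sets_PiM_I_finite) auto
    have "(\<lambda>\<omega>. \<lambda>i\<in>F. X i \<omega>) -` Pi\<^sub>E F A \<inter> space M = {\<omega> \<in> space M. \<forall>i\<in>F. X i \<omega> \<in> A i}"
      "(\<lambda>\<omega>. \<lambda>i\<in>F. Y i \<omega>) -` Pi\<^sub>E F A \<inter> space N = {\<omega> \<in> space N. \<forall>i\<in>F. Y i \<omega> \<in> A i}"
      by (auto simp: PiE_iff)
    then show "emeasure (distr M (\<Pi>\<^sub>M i\<in>F. borel) (\<lambda>\<omega>. \<lambda>i\<in>F. X i \<omega>)) (Pi\<^sub>E F A) =
        emeasure (distr N (\<Pi>\<^sub>M i\<in>F. borel) (\<lambda>\<omega>. \<lambda>i\<in>F. Y i \<omega>)) (Pi\<^sub>E F A)"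
      using box[OF A] by (simp add: emeasure_distr mX mY PA M.emeasure_eq_measure N.emeasure_eq_measure)
  next
    show "range (\<lambda>_::nat. \<Pi>\<^sub>E i\<in>F. UNIV) \<subseteq> prod_algebra F (\<lambda>_. borel :: real measure)"
      using fin by (auto intro!: prod_algebraI_finite)
  next
    interpret D: prob_space "distr M (\<Pi>\<^sub>M i\<in>F. borel) (\<lambda>\<omega>. \<lambda>i\<in>F. X i \<omega>)"
      by (rule M.prob_space_distr[OF mX])
    show "emeasure (distr M (\<Pi>\<^sub>M i\<in>F. borel) (\<lambda>\<omega>. \<lambda>i\<in>F. X i \<omega>)) (\<Pi>\<^sub>E i\<in>F. UNIV) \<noteq> \<infinity>"
      by simp
  qed (use fin in \<open>auto simp: space_PiM\<close>)
qed

section \<open>Gaussian processes and their covariance\<close>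

lemma centered_gaussian_variable:
  assumes "prob_space M" and Z: "gaussian_variable M Z" and mean: "(\<integral>\<omega>. Z \<omega> \<partial>M) = 0"
  shows "distr M borel Z = (if (\<integral>\<omega>. (Z \<omega>)\<^sup>2 \<partial>M) = 0 then return borel 0
      else density lborel (normal_density 0 (sqrt (\<integral>\<omega>. (Z \<omega>)\<^sup>2 \<partial>M))))"
proof -
  interpret prob_space M by fact
  have [measurable]: "Z \<in> borel_measurable M"
    using Z by (simp add: gaussian_variable_def)
  have mom: "(\<integral>\<omega>. f (Z \<omega>) \<partial>M) = (\<integral>x. f x \<partial>distr M borel Z)"
    if "f \<in> borel_measurable borel" for f :: "real \<Rightarrow> real"
    using that by (subst integral_distr) auto
  from Z consider c where "distr M borel Z = return borel c"
    | c \<sigma> where "\<sigma> > 0" "distributed M lborel Z (normal_density c \<sigma>)"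
    by (auto simp: gaussian_variable_def)
  then show ?thesis
  proof cases
    case 1
    have "c = 0" using mom[of "\<lambda>x. x"] mean 1 by (simp add: integral_return)
    moreover have "(\<integral>\<omega>. (Z \<omega>)\<^sup>2 \<partial>M) = c\<^sup>2" using mom[of "\<lambda>x. x\<^sup>2"] 1 by (simp add: integral_return)
    ultimately show ?thesis using 1 by simp
  next
    case 2
    then have "c = 0" using normal_distributed_expectation[OF 2] mean by simp
    moreover have "(\<integral>\<omega>. (Z \<omega>)\<^sup>2 \<partial>M) = \<sigma>\<^sup>2"
      using normal_distributed_variance[OF 2] mean by simp
    moreover have "distr M borel Z = density lborel (normal_density c \<sigma>)"
      using distributed_distr_eq_density[OF 2(2)] by (simp cong: distr_cong)
    ultimately show ?thesis using 2(1) by simp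
  qed
qed

text \<open>Bochner integrals of functions that are not integrable are zero by convention, so the
covariances carry information, and are bilinear, only because of this integrability.\<close>

lemma gaussian_variable_square_integrable:
  assumes "prob_space M" and Z: "gaussian_variable M Z"
  shows "integrable M (\<lambda>\<omega>. (Z \<omega>)\<^sup>2)"
proof -
  interpret prob_space M by fact
  have [measurable]: "Z \<in> borel_measurable M"
    using Z by (simp add: gaussian_variable_def)
  from Z consider c where "distr M borel Z = return borel c"
    | c \<sigma> where "\<sigma> > 0" "distributed M lborel Z (normal_density c \<sigma>)"
    by (auto simp: gaussian_variable_def)
  then show ?thesis
  proof cases
    case 1
    have "integrable (distr M borel Z) (\<lambda>x. x\<^sup>2)"
      unfolding 1 by (intro integrableI_bounded) (auto simp: nn_integral_return)
    then show ?thesis by (simp add: integrable_distr_eq)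
  next
    case 2
    have "integrable lborel (\<lambda>x. normal_density c \<sigma> x * x\<^sup>2)"
    proof -
      have "integrable lborel (\<lambda>x. normal_density c \<sigma> x * (x - c)^2
          + 2 * c * (normal_density c \<sigma> x * x) - c\<^sup>2 * normal_density c \<sigma> x)"
        using 2(1) by (intro Bochner_Integration.integrable_add Bochner_Integration.integrable_diff
            integrable_mult_right integrable_normal_moment integrable_normal_moment_nz_1 integrable_normal_density)
      then show ?thesis
        by (simp add: power2_eq_square algebra_simps)
    qed
    then show ?thesis
      using distributed_integrable[OF 2(2), of "\<lambda>x. x\<^sup>2"] by simp
  qed
qed

lemma gaussian_process_sum:
  assumes "gaussian_process M I X" "finite F" "F \<subseteq> I"
  shows "gaussian_variable M (\<lambda>\<omega>. \<Sum>i\<in>F. c i * X i \<omega>)"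
  using assms by (simp add: gaussian_process_def)

lemma gaussian_process_variable:
  assumes "gaussian_process M I X" "U \<in> I"
  shows "gaussian_variable M (X U)"
  using gaussian_process_sum[OF assms(1), of "{U}" "\<lambda>_. 1"] assms(2) by simp

lemma gaussian_process_integrable:
  assumes X: "gaussian_process M I X" and I: "U \<in> I" "V \<in> I"
  shows "integrable M (X U)" "integrable M (\<lambda>\<omega>. X U \<omega> * X V \<omega>)"
proof -
  interpret prob_space M using X by (simp add: gaussian_process_def)
  have g: "gaussian_variable M (X W)" if "W \<in> I" for W
    using gaussian_process_variable[OF X that] .
  then have m: "X W \<in> borel_measurable M" if "W \<in> I" for W
    using that by (simp add: gaussian_variable_def)
  have sq: "integrable M (\<lambda>\<omega>. (X W \<omega>)\<^sup>2)" if "W \<in> I" for W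
    using gaussian_variable_square_integrable[OF prob_space_axioms g[OF that]] .
  show "integrable M (X U)"
    using square_integrable_imp_integrable[OF m sq] I by simp
  show "integrable M (\<lambda>\<omega>. X U \<omega> * X V \<omega>)"
  proof (rule Bochner_Integration.integrable_bound)
    show "integrable M (\<lambda>\<omega>. (X U \<omega>)\<^sup>2 + (X V \<omega>)\<^sup>2)" using sq I by simp
    have "\<bar>a * b\<bar> \<le> \<bar>a\<^sup>2 + b\<^sup>2\<bar>" for a b :: real
    proof -
      have "2 * (\<bar>a\<bar> * \<bar>b\<bar>) \<le> a\<^sup>2 + b\<^sup>2"
        using sum_squares_bound[of "\<bar>a\<bar>" "\<bar>b\<bar>"] by (simp add: mult.assoc)
      moreover have "0 \<le> \<bar>a\<bar> * \<bar>b\<bar>" by simp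
      ultimately show ?thesis unfolding abs_mult by linarith
    qed
    then show "AE \<omega> in M. norm (X U \<omega> * X V \<omega>) \<le> norm ((X U \<omega>)\<^sup>2 + (X V \<omega>)\<^sup>2)"
      by simp
  qed (use m I in simp)
qed

lemma gaussian_process_reindex:
  assumes X: "gaussian_process M I X" and h: "inj_on h J" "h ` J \<subseteq> I"
  shows "gaussian_process M J (\<lambda>U \<omega>. a * X (h U) \<omega>)"
  unfolding gaussian_process_def
proof (intro conjI allI impI)
  fix F c assume F: "finite F" "F \<subseteq> J"
  have inj: "inj_on h F" using h(1) F(2) by (rule inj_on_subset)
  \<comment> \<open>Injectivity of h lets the coefficients be transported to the index set h ` F.\<close>
  have "gaussian_variable M (\<lambda>\<omega>. \<Sum>i\<in>h ` F. (a * c (the_inv_into F h i)) * X i \<omega>)"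
    using F h(2) by (intro gaussian_process_sum[OF X]) auto
  also have "(\<lambda>\<omega>. \<Sum>i\<in>h ` F. (a * c (the_inv_into F h i)) * X i \<omega>) =
      (\<lambda>\<omega>. \<Sum>i\<in>F. c i * (a * X (h i) \<omega>))"
    by (rule ext) (simp add: sum.reindex[OF inj] the_inv_into_f_f[OF inj] mult_ac)
  finally show "gaussian_variable M (\<lambda>\<omega>. \<Sum>i\<in>F. c i * (a * X (h i) \<omega>))" .
qed (use X in \<open>simp add: gaussian_process_def\<close>)

lemma gaussian_process_moments:
  assumes X: "gaussian_process M I X" and F: "F \<subseteq> I"
  shows "(\<integral>\<omega>. (\<Sum>i\<in>F. c i * X i \<omega>) \<partial>M) = (\<Sum>i\<in>F. c i * (\<integral>\<omega>. X i \<omega> \<partial>M))"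
    and "(\<integral>\<omega>. (\<Sum>i\<in>F. c i * X i \<omega>)\<^sup>2 \<partial>M) = (\<Sum>i\<in>F. \<Sum>j\<in>F. c i * c j * (\<integral>\<omega>. X i \<omega> * X j \<omega> \<partial>M))"
proof -
  have i1: "integrable M (X i)" and i2: "integrable M (\<lambda>\<omega>. X i \<omega> * X j \<omega>)" if "i \<in> F" "j \<in> F" for i j
    using gaussian_process_integrable[OF X, of i j] F that by auto
  show "(\<integral>\<omega>. (\<Sum>i\<in>F. c i * X i \<omega>) \<partial>M) = (\<Sum>i\<in>F. c i * (\<integral>\<omega>. X i \<omega> \<partial>M))"
    using i1 by (subst Bochner_Integration.integral_sum) auto
  have "(\<integral>\<omega>. (\<Sum>i\<in>F. c i * X i \<omega>)\<^sup>2 \<partial>M) = (\<integral>\<omega>. (\<Sum>i\<in>F. \<Sum>j\<in>F. c i * c j * (X i \<omega> * X j \<omega>)) \<partial>M)"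
    by (simp add: power2_eq_square sum_product mult_ac)
  also have "\<dots> = (\<Sum>i\<in>F. (\<integral>\<omega>. (\<Sum>j\<in>F. c i * c j * (X i \<omega> * X j \<omega>)) \<partial>M))"
    using i2 by (intro Bochner_Integration.integral_sum Bochner_Integration.integrable_sum integrable_mult_right)
  also have "\<dots> = (\<Sum>i\<in>F. \<Sum>j\<in>F. (\<integral>\<omega>. c i * c j * (X i \<omega> * X j \<omega>) \<partial>M))"
    using i2 by (intro sum.cong refl Bochner_Integration.integral_sum integrable_mult_right)
  finally show "(\<integral>\<omega>. (\<Sum>i\<in>F. c i * X i \<omega>)\<^sup>2 \<partial>M) =
      (\<Sum>i\<in>F. \<Sum>j\<in>F. c i * c j * (\<integral>\<omega>. X i \<omega> * X j \<omega> \<partial>M))"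
    by simp
qed

text \<open>The variance of a linear combination is a quadratic form in the covariances, so linear
combinations with equal coefficients are centered Gaussian variables with equal variance.\<close>

lemma gaussian_process_same_lawI:
  assumes X: "gaussian_process M I X" and Y: "gaussian_process N I Y"
    and cX: "\<And>U. U \<in> I \<Longrightarrow> (\<integral>\<omega>. X U \<omega> \<partial>M) = 0"
    and cY: "\<And>U. U \<in> I \<Longrightarrow> (\<integral>\<omega>. Y U \<omega> \<partial>N) = 0"
    and cov: "\<And>U V. U \<in> I \<Longrightarrow> V \<in> I \<Longrightarrow>
      (\<integral>\<omega>. X U \<omega> * X V \<omega> \<partial>M) = (\<integral>\<omega>. Y U \<omega> * Y V \<omega> \<partial>N)"
  shows "same_law M N I X Y"
  unfolding same_law_def
proof (intro allI impI)
  fix F assume F: "finite F" "F \<subseteq> I"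
  have ps: "prob_space M" "prob_space N" using X Y by (simp_all add: gaussian_process_def)
  show "distr M (\<Pi>\<^sub>M i\<in>F. borel) (\<lambda>\<omega>. \<lambda>i\<in>F. X i \<omega>) =
      distr N (\<Pi>\<^sub>M i\<in>F. borel) (\<lambda>\<omega>. \<lambda>i\<in>F. Y i \<omega>)"
  proof (rule cramer_wold[OF ps F(1)])
    show "X i \<in> borel_measurable M" "Y i \<in> borel_measurable N" if "i \<in> F" for i
      using gaussian_process_variable[OF X, of i] gaussian_process_variable[OF Y, of i] that F(2)
      by (auto simp: gaussian_variable_def)
    fix c
    have g: "gaussian_variable M (\<lambda>\<omega>. \<Sum>i\<in>F. c i * X i \<omega>)"
      "gaussian_variable N (\<lambda>\<omega>. \<Sum>i\<in>F. c i * Y i \<omega>)"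
      using gaussian_process_sum[OF X F] gaussian_process_sum[OF Y F] by auto
    have m0: "(\<integral>\<omega>. (\<Sum>i\<in>F. c i * X i \<omega>) \<partial>M) = 0" "(\<integral>\<omega>. (\<Sum>i\<in>F. c i * Y i \<omega>) \<partial>N) = 0"
      using cX cY F(2)
      by (auto simp: gaussian_process_moments(1)[OF X F(2)] gaussian_process_moments(1)[OF Y F(2)]
          intro!: sum.neutral)
    have "(\<integral>\<omega>. (\<Sum>i\<in>F. c i * X i \<omega>)\<^sup>2 \<partial>M) = (\<integral>\<omega>. (\<Sum>i\<in>F. c i * Y i \<omega>)\<^sup>2 \<partial>N)"
      unfolding gaussian_process_moments(2)[OF X F(2)] gaussian_process_moments(2)[OF Y F(2)]
      using cov F(2) by (intro sum.cong) auto
    then show "distr M borel (\<lambda>\<omega>. \<Sum>i\<in>F. c i * X i \<omega>) = distr N borel (\<lambda>\<omega>. \<Sum>i\<in>F. c i * Y i \<omega>)"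
      by (simp add: centered_gaussian_variable[OF ps(1) g(1) m0(1)]
          centered_gaussian_variable[OF ps(2) g(2) m0(2)])
  qed
qed

section \<open>Scaling of symmetric differences under the action\<close>

lemma measure_sym_diff:
  assumes "A \<in> sets m" "B \<in> sets m" "emeasure m A < \<infinity>" "emeasure m B < \<infinity>"
  shows "measure m (sym_diff A B) = measure m A + measure m B - 2 * measure m (A \<inter> B)"
proof -
  have f: "A \<in> fmeasurable m" "B \<in> fmeasurable m"
    using assms by (auto simp: fmeasurable_def)
  have "measure m (sym_diff A B) = measure m (A - B) + measure m (B - A)"
    using f by (intro measure_Un_AE) (auto intro: fmeasurable_Diff)
  moreover have "measure m (A - B) = measure m A - measure m (A \<inter> B)"
    using measure_Diff[of m A "A \<inter> B"] f assms by (auto simp: Diff_Int2 Diff_Int)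
  moreover have "measure m (B - A) = measure m B - measure m (A \<inter> B)"
    using measure_Diff[of m B "A \<inter> B"] f assms by (auto simp: Diff_Int2 Diff_Int)
  ultimately show ?thesis by simp
qed

text \<open>The set \<open>U - V = U - (U \<inter> V)\<close> is a difference of members of \<open>\<A>\<close> in two
ways. Comparing the two values of the extended action shows that \<open>\<phi> x (U \<inter> V)\<close> and \<open>\<phi> x V\<close> have the same trace
on \<open>\<phi> x U\<close>; and \<open>\<phi> x (U \<inter> V)\<close> lies inside \<open>\<phi> x U\<close> since compatibility with unions makes the
action monotone.\<close>

lemma extended_action_Int:
  assumes ext: "extends_to_unions_diffs G \<A> \<phi>"
    and x: "x \<in> carrier G" and mem: "U \<in> \<A>" "V \<in> \<A>" "U \<inter> V \<in> \<A>"
  shows "\<phi> x (U \<inter> V) = \<phi> x U \<inter> \<phi> x V"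
proof -
  from ext obtain \<psi> where ag0: "\<forall>x\<in>carrier G. \<forall>U\<in>\<A>. \<psi> x U = \<phi> x U"
    and ud0: "\<forall>x\<in>carrier G. \<forall>U\<in>\<A>. \<forall>V\<in>\<A>.
      \<psi> x (U \<union> V) = \<psi> x U \<union> \<psi> x V \<and> \<psi> x (U - V) = \<psi> x U - \<psi> x V"
    unfolding extends_to_unions_diffs_def by (elim exE conjE)
  have ag: "\<psi> x U' = \<phi> x U'" if "U' \<in> \<A>" for U'
    using ag0 x that by simp
  have un: "\<psi> x (U' \<union> V') = \<phi> x U' \<union> \<phi> x V'"
    and di: "\<psi> x (U' - V') = \<phi> x U' - \<phi> x V'" if "U' \<in> \<A>" "V' \<in> \<A>" for U' V'
    using ud0[rule_format, OF x that] ag that by simp_all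
  have sub: "\<phi> x (U \<inter> V) \<subseteq> \<phi> x W" if "W \<in> \<A>" "U \<inter> V \<subseteq> W" for W
    using un[OF that(1) mem(3)] ag[OF that(1)] that(2) by (auto simp: Un_absorb2)
  \<comment> \<open>Evaluating the extension on U - V in two ways.\<close>
  have "\<phi> x U - \<phi> x (U \<inter> V) = \<psi> x (U - (U \<inter> V))" using di mem by simp
  also have "U - (U \<inter> V) = U - V" by blast
  also have "\<psi> x (U - V) = \<phi> x U - \<phi> x V" using di mem by simp
  finally show ?thesis using sub[of U] sub[of V] mem by blast
qed

lemma measure_sym_diff_scales:
  assumes ext: "extends_to_unions_diffs G \<A> \<phi>" and x: "x \<in> carrier G"
    and stable: "\<And>U. U \<in> \<A> \<Longrightarrow> \<phi> x U \<in> \<A>"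
      "\<And>U V. U \<in> \<A> \<Longrightarrow> V \<in> \<A> \<Longrightarrow> U \<inter> V \<in> \<A>"
    and fin: "\<And>U. U \<in> \<A> \<Longrightarrow> U \<in> sets m" "\<And>U. U \<in> \<A> \<Longrightarrow> emeasure m U < \<infinity>"
    and scale: "\<And>U. U \<in> \<A> \<Longrightarrow> measure m (\<phi> x U) = c * measure m U"
    and mem: "U \<in> \<A>" "V \<in> \<A>"
  shows "measure m (sym_diff (\<phi> x U) (\<phi> x V)) = c * measure m (sym_diff U V)"
proof -
  have "measure m (sym_diff (\<phi> x U) (\<phi> x V)) =
      measure m (\<phi> x U) + measure m (\<phi> x V) - 2 * measure m (\<phi> x (U \<inter> V))"
    using extended_action_Int[OF ext x mem stable(2)[OF mem]] fin stable(1) mem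
    by (simp add: measure_sym_diff)
  also have "\<dots> = c * measure m (sym_diff U V)"
    using scale stable(2) fin mem by (simp add: measure_sym_diff algebra_simps)
  finally show ?thesis .
qed

section \<open>Self-similarity\<close>

theorem proposition3p12:
  fixes \<A> :: "'a::polish_space set set"
    and m :: "'a measure"
    and M :: "'w measure"
    and BH :: "'a set \<Rightarrow> 'w \<Rightarrow> real"
    and H :: real
    and G :: "('g, 'x) monoid_scheme"
    and \<phi> :: "'g \<Rightarrow> 'a set \<Rightarrow> 'a set"
    and \<mu> :: "'g \<Rightarrow> real"
  assumes "locally compact (UNIV :: 'a set)"
    and "indexing_collection \<A>"
    and "sets m = sets borel"
    and "\<And>U. U \<in> \<A> \<Longrightarrow> emeasure m U < \<infinity>"
    and "0 < H" and "H \<le> 1 / 2"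
    and "sifBm M m \<A> H BH"
    and "group G" and "carrier G \<noteq> {\<one>\<^bsub>G\<^esub>}"
    and "group_action G \<A> \<phi>"
    and "extends_to_unions_diffs G \<A> \<phi>"
    and "\<And>x. x \<in> carrier G \<Longrightarrow> 0 < \<mu> x"
    and "\<exists>x\<in>carrier G. \<exists>y\<in>carrier G. \<mu> x \<noteq> \<mu> y"
    and "\<And>x U. x \<in> carrier G \<Longrightarrow> U \<in> \<A> \<Longrightarrow> measure m (\<phi> x U) = \<mu> x * measure m U"
  shows "\<forall>x\<in>carrier G.
    same_law M M \<A> (\<lambda>U \<omega>. BH (\<phi> x U) \<omega>) (\<lambda>U \<omega>. \<mu> x powr H * BH U \<omega>)"
proof
  fix x assume x: "x \<in> carrier G"
  note ext = \<open>extends_to_unions_diffs G \<A> \<phi>\<close>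
  note scale = assms(14)[OF x]
  have \<mu>: "0 < \<mu> x" by (rule assms(12)[OF x])
  obtain B An g where "indexing_data \<A> B An g"
    using assms(2) unfolding indexing_collection_def by blast
  then interpret indexing_data \<A> B An g .
  have Int: "U \<inter> V \<in> \<A>" if "U \<in> \<A>" "V \<in> \<A>" for U V
    using Inter_mem[of "{U, V}"] that by simp
  have meas: "U \<in> sets m" if "U \<in> \<A>" for U
    using compact[OF that] assms(3) by (simp add: borel_closed compact_imp_closed)
  have bij: "bij_betw (\<phi> x) \<A> \<A>"
    using group_action.bij_prop0[OF \<open>group_action G \<A> \<phi>\<close> x] by (simp add: Bij_def)
  then have stable: "\<phi> x U \<in> \<A>" if "U \<in> \<A>" for U
    using that by (auto simp: bij_betw_def)
  from \<open>sifBm M m \<A> H BH\<close> have gp: "gaussian_process M \<A> BH"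
    and mean: "\<And>U. U \<in> \<A> \<Longrightarrow> (\<integral>\<omega>. BH U \<omega> \<partial>M) = 0"
    and cov: "\<And>U V. U \<in> \<A> \<Longrightarrow> V \<in> \<A> \<Longrightarrow> (\<integral>\<omega>. BH U \<omega> * BH V \<omega> \<partial>M) =
        1 / 2 * (measure m U powr (2 * H) + measure m V powr (2 * H)
                 - measure m (sym_diff U V) powr (2 * H))"
    unfolding sifBm_def by auto
  show "same_law M M \<A> (\<lambda>U \<omega>. BH (\<phi> x U) \<omega>) (\<lambda>U \<omega>. \<mu> x powr H * BH U \<omega>)"
  proof (rule gaussian_process_same_lawI)
    show "gaussian_process M \<A> (\<lambda>U \<omega>. BH (\<phi> x U) \<omega>)"
      using gaussian_process_reindex[OF gp, of "\<phi> x" \<A> 1] bij by (simp add: bij_betw_def)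
    show "gaussian_process M \<A> (\<lambda>U \<omega>. \<mu> x powr H * BH U \<omega>)"
      using gaussian_process_reindex[OF gp, of "\<lambda>U. U" \<A> "\<mu> x powr H"] by simp
    show "(\<integral>\<omega>. BH (\<phi> x U) \<omega> \<partial>M) = 0" "(\<integral>\<omega>. \<mu> x powr H * BH U \<omega> \<partial>M) = 0"
      if "U \<in> \<A>" for U
      using mean stable that by simp_all
    fix U V assume UV: "U \<in> \<A>" "V \<in> \<A>"
    have sq: "\<mu> x powr (2 * H) = \<mu> x powr H * \<mu> x powr H"
      by (simp add: powr_add[symmetric])
    have "(\<integral>\<omega>. BH (\<phi> x U) \<omega> * BH (\<phi> x V) \<omega> \<partial>M) =
        1 / 2 * ((\<mu> x * measure m U) powr (2 * H) + (\<mu> x * measure m V) powr (2 * H)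
          - (\<mu> x * measure m (sym_diff U V)) powr (2 * H))"
      using cov[OF stable stable, OF UV] scale UV
        measure_sym_diff_scales[OF ext x stable Int meas assms(4) scale UV] by simp
    also have "\<dots> = \<mu> x powr (2 * H) * (\<integral>\<omega>. BH U \<omega> * BH V \<omega> \<partial>M)"
      unfolding cov[OF UV] using \<mu> by (simp add: powr_mult algebra_simps)
    also have "\<dots> = (\<integral>\<omega>. (\<mu> x powr H * \<mu> x powr H) * (BH U \<omega> * BH V \<omega>) \<partial>M)"
      by (simp add: sq)
    also have "\<dots> = (\<integral>\<omega>. \<mu> x powr H * BH U \<omega> * (\<mu> x powr H * BH V \<omega>) \<partial>M)"
      by (simp add: mult_ac)
    finally show "(\<integral>\<omega>. BH (\<phi> x U) \<omega> * BH (\<phi> x V) \<omega> \<partial>M) =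
        (\<integral>\<omega>. \<mu> x powr H * BH U \<omega> * (\<mu> x powr H * BH V \<omega>) \<partial>M)" .
  qed
qed

end
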